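(* Let $r, t, k\in\mathbb{N}$. There exists a partition $\mathbb{N}^k=\bigcup_{i=1}^r E_i$ such that for every finite coloring of $\mathbb{N}^k$ with $t$ colors, $\mathbb{N}^k=\bigcup_{j=1}^t F_j$, there exist a single color class $F_m$, $1\le m\le t$, an element $x_0\in\mathbb{N}$, and a sequence $\{x_n\}_{n\ge 1}$ in $\mathbb{N}$ such that for every $h\in x_0+\mathrm{FS}(\{x_n\}_{n\ge 1})$ and every $i\in\{1,2,\ldots,r\}$, the set $(F_m+h\mathbf{1}_k)\cap E_i$ has infinitely many elements.
   Context: $\mathbb{N}$ is the set of positive integers. $\mathbf{1}_k=(1,\dots,1)\in\mathbb{N}^k$. For $F\subseteq\mathbb{N}^k$ and $h\in\mathbb{N}$, $F+h\mathbf{1}_k=\{\mathbf{a}+h\mathbf{1}_k:\mathbf{a}\in F\}$. A coloring of $\mathbb{N}^k$ with $t$ colors is a partition of $\mathbb{N}^k$ into $t$ pairwise disjoint sets $F_1,\dots,F_t$ (the color classes). For a sequence $\{x_n\}_{n\ge1}$, $\mathrm{FS}(\{x_n\}_{n\ge 1})$ is the set of all finite sums formed by its elements, i.e. $\{\sum_{n\in I}x_n: I\subset\mathbb{N}\text{ finite, nonempty}\}$ (each index used at most once), and $x_0+\mathrm{FS}(\{x_n\}_{n\ge1})=\{x_0+s: s\in \mathrm{FS}(\{x_n\}_{n\ge1})\}$. *)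

theory Defs
  imports "HOL-Analysis.Finite_Cartesian_Product" "HOL-Library.Disjoint_Sets"
begin

text \<open>
  The set of positive integers is rendered as \<open>{1..} :: nat set\<close>. The exponent \<open>k\<close> is the
  cardinality of the (nonempty, finite) index type \<open>'k\<close>, so that an arbitrary \<open>k \<ge> 1\<close> is
  an arbitrary \<open>'k::finite\<close>.
\<close>

definition pos_vecs :: "(nat ^ 'k) set" where
  "pos_vecs = {a. \<forall>i. a $ i \<in> {1..}}"

text \<open>Classes may be empty: a coloring with \<open>t\<close> colors need not use every color.\<close>

definition indexed_partition :: "nat \<Rightarrow> (nat \<Rightarrow> 'a set) \<Rightarrow> 'a set \<Rightarrow> bool" where
  "indexed_partition n P A \<longleftrightarrow> disjoint_family_on P {1..n} \<and> (\<Union>i\<in>{1..n}. P i) = A"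

text \<open>\<open>vec h\<close> is the constant vector, i.e. \<open>h\<close> times the all-ones vector.\<close>

definition diag_shift :: "(nat ^ 'k) set \<Rightarrow> nat \<Rightarrow> (nat ^ 'k) set" where
  "diag_shift F h = {a + vec h | a. a \<in> F}"

text \<open>Sequences are indexed from 1; the value at index 0 plays no role.\<close>

definition FS :: "(nat \<Rightarrow> nat) \<Rightarrow> nat set" where
  "FS x = {\<Sum>n\<in>I. x n | I. I \<subseteq> {1..} \<and> finite I \<and> I \<noteq> {}}"

end

theory Submission
  imports Defs "HOL-Library.Countable" "HOL-Library.Discrete_Functions"
begin

text \<open>
  Let \<open>e\<close> be an \<open>r\<close>-valued sequence in which every finite word occurs infinitely often, and let
  \<open>E\<^sub>i\<close> consist of the vectors \<open>a\<close> with \<open>e a\<^sub>1 = i\<close> for one fixed coordinate \<open>a\<^sub>1\<close>. Call \<open>h\<close> bad for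
  a color \<open>m\<close> if \<open>F\<^sub>m + h\<one>\<close> meets some \<open>E\<^sub>i\<close> in a finite set only. If every color had infinitely many
  bad shifts, one could choose distinct bad shifts \<open>h\<^sub>m\<close> with witnesses \<open>i\<^sub>m\<close>; infinitely many \<open>n\<close>
  satisfy \<open>e (n + h\<^sub>m) = i\<^sub>m\<close> for all \<open>m\<close>, but only finitely many of the constant vectors
  \<open>n\<one>\<close> could belong to any \<open>F\<^sub>m\<close>. So some color has only finitely many bad shifts, and every
  \<open>x\<^sub>0\<close> beyond them works, with any sequence \<open>x\<close>. In particular Hindman's theorem is not needed.
\<close>

text \<open>Words over a countable alphabet can be enumerated with infinite repetition;
  \<open>e\<close> lays such an enumeration out along the naturals.\<close>

lemma ex_sequence_containing_all_words:
  fixes A :: "'a::countable set"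
  assumes "A \<noteq> {}"
  shows "\<exists>e :: nat \<Rightarrow> 'a. range e \<subseteq> A \<and>
    (\<forall>w. set w \<subseteq> A \<longrightarrow> infinite {n. \<forall>j<length w. e (n + j) = w ! j})"
proof -
  obtain a where a: "a \<in> A" using assms by blast
  \<comment> \<open>The discarded second component of the pair makes every word equal to
    \<open>word s\<close> for infinitely many \<open>s\<close>.\<close>
  define word :: "nat \<Rightarrow> 'a list" where "word s = from_nat (fst (prod_decode s))" for s
  \<comment> \<open>The default \<open>a\<close> fills the rest of a block and replaces letters
    outside \<open>A\<close>.\<close>
  define letter where "letter w j = (if j < length w \<and> w ! j \<in> A then w ! j else a)" for w j
  \<comment> \<open>The dyadic block \<open>[2^s, 2^(s+1))\<close> starts with (a truncation of) \<open>word s\<close>.\<close>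
  define e where "e n = letter (word (floor_log n)) (n - 2 ^ floor_log n)" for n
  have "range e \<subseteq> A" using a by (auto simp: e_def letter_def)
  moreover have "infinite {n. \<forall>j<length w. e (n + j) = w ! j}" if w: "set w \<subseteq> A" for w
  proof -
    define code where "code q = prod_encode (to_nat w, q)" for q
    have word_code: "word (code q) = w" for q by (simp add: word_def code_def)
    have "inj code" by (auto simp: code_def inj_on_def)
    \<comment> \<open>The block has length \<open>2 ^ code q\<close>, which exceeds
      \<open>q\<close>, so it has room for all of \<open>w\<close>.\<close>
    have occurs: "e (2 ^ code q + j) = w ! j" if "length w \<le> q" "j < length w" for q j
    proof -
      have "q \<le> code q" by (simp add: code_def le_prod_encode_2)
      then have "j < 2 ^ code q"
        using that less_exp[of "code q"] by linarith
      then have "floor_log (2 ^ code q + j) = code q"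
        by (intro floor_log_eqI) auto
      moreover have "w ! j \<in> A" using w nth_mem[OF that(2)] by blast
      ultimately show ?thesis
        using that by (simp add: e_def word_code letter_def)
    qed
    have "inj (\<lambda>q. 2 ^ code q :: nat)"
      using \<open>inj code\<close> by (auto simp: inj_on_def)
    then have "infinite ((\<lambda>q. 2 ^ code q :: nat) ` {length w..})"
      by (meson finite_imageD infinite_Ici inj_on_subset subset_UNIV)
    moreover have "(\<lambda>q. 2 ^ code q) ` {length w..} \<subseteq> {n. \<forall>j<length w. e (n + j) = w ! j}"
      using occurs by auto
    ultimately show ?thesis by (rule infinite_super[rotated])
  qed
  ultimately show ?thesis by blast
qed

text \<open>Choose greedily: finitely many earlier values cannot exhaust an infinite set.
  Distinctness will let one word prescribe a letter at each chosen shift independently.\<close>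

lemma infinite_sets_distinct_representatives:
  assumes "finite I" and "\<And>m. m \<in> I \<Longrightarrow> infinite (B m)"
  shows "\<exists>h. inj_on h I \<and> (\<forall>m\<in>I. h m \<in> B m)"
  using assms
proof (induction I rule: finite_induct)
  case (insert p I)
  then obtain h where h: "inj_on h I" "\<forall>m\<in>I. h m \<in> B m" by auto
  have "infinite (B p - h ` I)" using insert by (simp add: Diff_infinite_finite)
  then obtain b where "b \<in> B p" "b \<notin> h ` I"
    by (metis Diff_iff ex_in_conv finite.emptyI)
  then have "inj_on (h(p := b)) (insert p I) \<and> (\<forall>m\<in>insert p I. (h(p := b)) m \<in> B m)"
    using h insert.hyps by (auto simp: inj_on_def)
  then show ?case by blast
qed simp

lemma ex_color_finite_bad_shifts:
  fixes e :: "nat \<Rightarrow> nat" and F :: "nat \<Rightarrow> (nat ^ 'k::finite) set" and k :: 'k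
  assumes words: "\<And>w. set w \<subseteq> {1..r} \<Longrightarrow> infinite {n. \<forall>j<length w. e (n + j) = w ! j}"
    and r: "r \<ge> 1" and F: "indexed_partition t F pos_vecs"
  shows "\<exists>m\<in>{1..t}.
    finite {h. \<exists>i\<in>{1..r}. finite (diag_shift (F m) h \<inter> {a \<in> pos_vecs. e (a $ k) = i})}"
proof (rule ccontr)
  assume contra: "\<not> ?thesis"
  define B where
    "B m = {h. \<exists>i\<in>{1..r}. finite (diag_shift (F m) h \<inter> {a \<in> pos_vecs. e (a $ k) = i})}" for m
  have "\<exists>h. inj_on h {1..t} \<and> (\<forall>m\<in>{1..t}. h m \<in> B m)"
    using contra by (intro infinite_sets_distinct_representatives) (auto simp: B_def)
  then obtain h where inj: "inj_on h {1..t}" and hB: "\<forall>m\<in>{1..t}. h m \<in> B m" by blast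
  then have "\<forall>m\<in>{1..t}. \<exists>i. i \<in> {1..r} \<and>
      finite (diag_shift (F m) (h m) \<inter> {a \<in> pos_vecs. e (a $ k) = i})"
    unfolding B_def by blast
  then obtain c where "\<forall>m\<in>{1..t}. c m \<in> {1..r} \<and>
      finite (diag_shift (F m) (h m) \<inter> {a \<in> pos_vecs. e (a $ k) = c m})"
    by (rule bchoice[THEN exE])
  then have c: "\<forall>m\<in>{1..t}. c m \<in> {1..r}"
    and fin: "\<forall>m\<in>{1..t}. finite (diag_shift (F m) (h m) \<inter> {a \<in> pos_vecs. e (a $ k) = c m})"
    by simp_all
  \<comment> \<open>The injective shift by \<open>h m\<close> carries \<open>D m\<close> into a set
    that is finite by the choice of \<open>c m\<close>.\<close>
  define D where "D m = {a \<in> F m. e (a $ k + h m) = c m}" for m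
  have finD: "finite (D m)" if m: "m \<in> {1..t}" for m
  proof -
    have "a + vec (h m) \<in> pos_vecs" if "a \<in> D m" for a
    proof -
      have "a \<in> pos_vecs" using F m that by (auto simp: indexed_partition_def D_def)
      then show ?thesis by (simp add: pos_vecs_def trans_le_add1)
    qed
    then have "(\<lambda>a. a + vec (h m)) ` D m \<subseteq>
        diag_shift (F m) (h m) \<inter> {a \<in> pos_vecs. e (a $ k) = c m}"
      by (auto simp: D_def diag_shift_def)
    then have "finite ((\<lambda>a. a + vec (h m)) ` D m)"
      using fin m finite_subset by blast
    then show ?thesis by (rule finite_imageD) (simp add: inj_on_def)
  qed
  define g where "g = the_inv_into {1..t} h"
  \<comment> \<open>\<open>w\<close> has the letter \<open>c m\<close> at position
    \<open>h m\<close>, consistently because \<open>h\<close> is injective; the filler 1 is a letter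
    since \<open>r \<ge> 1\<close>.\<close>
  define w where "w = map (\<lambda>j. if j \<in> h ` {1..t} then c (g j) else 1)
    [0..<Suc (Max (h ` {1..t}))]"
  \<comment> \<open>Removing 0 keeps \<open>vec n\<close> inside \<open>pos_vecs\<close>.\<close>
  define S where "S = {n. \<forall>j<length w. e (n + j) = w ! j} - {0}"
  have g: "g (h m) = m" if "m \<in> {1..t}" for m
    using that inj by (simp add: g_def the_inv_into_f_f)
  have "set w \<subseteq> {1..r}"
    using c g r by (auto simp: w_def simp del: upt_Suc)
  then have "infinite S"
    using words by (simp add: S_def)
  have hit: "e (n + h m) = c m" if "n \<in> S" "m \<in> {1..t}" for n m
  proof -
    have "h m < Suc (Max (h ` {1..t}))" using that by (simp add: less_Suc_eq_le)
    then have "w ! h m = c m" "h m < length w"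
      using that g by (auto simp: w_def simp del: upt_Suc)
    then show ?thesis using that by (simp add: S_def)
  qed
  \<comment> \<open>Whichever color \<open>m\<close> the vector \<open>vec n\<close> has, its
    coordinate \<open>k\<close> is \<open>n\<close>, so \<open>hit\<close> puts it into
    \<open>D m\<close>.\<close>
  have "vec ` S \<subseteq> (\<Union>m\<in>{1..t}. D m)"
  proof
    fix a :: "nat ^ 'k" assume "a \<in> vec ` S"
    then obtain n where n: "n \<in> S" "a = vec n" by blast
    then have "a \<in> pos_vecs" by (auto simp: pos_vecs_def S_def)
    then obtain m where "m \<in> {1..t}" "a \<in> F m"
      using F unfolding indexed_partition_def by blast
    then show "a \<in> (\<Union>m\<in>{1..t}. D m)" using n hit by (auto simp: D_def)
  qed
  then have "finite (vec ` S :: (nat ^ 'k) set)"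
    by (rule finite_subset) (use finD in blast)
  then have "finite S"
    by (rule finite_imageD) (auto simp: inj_on_def vec_eq_iff)
  with \<open>infinite S\<close> show False by blast
qed

theorem theorem1p2:
  fixes r t :: nat
  assumes "r \<ge> 1" and "t \<ge> 1"
  shows "\<exists>E :: nat \<Rightarrow> (nat ^ 'k::finite) set.
    indexed_partition r E pos_vecs \<and>
    (\<forall>F :: nat \<Rightarrow> (nat ^ 'k) set. indexed_partition t F pos_vecs \<longrightarrow>
      (\<exists>m\<in>{1..t}. \<exists>x0\<in>{1..}. \<exists>x :: nat \<Rightarrow> nat. (\<forall>n\<ge>1. x n \<in> {1..}) \<and>
        (\<forall>h\<in>{x0 + s | s. s \<in> FS x}. \<forall>i\<in>{1..r}.
          infinite (diag_shift (F m) h \<inter> E i))))"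
proof -
  have "{1..r} \<noteq> {}" using assms by simp
  from ex_sequence_containing_all_words[OF this]
  obtain e :: "nat \<Rightarrow> nat" where e: "range e \<subseteq> {1..r}"
    and words: "\<And>w. set w \<subseteq> {1..r} \<Longrightarrow> infinite {n. \<forall>j<length w. e (n + j) = w ! j}"
    by blast
  \<comment> \<open>Any coordinate serves, and one exists because index types are nonempty.\<close>
  fix k :: 'k
  define E :: "nat \<Rightarrow> (nat ^ 'k) set" where "E i = {a \<in> pos_vecs. e (a $ k) = i}" for i
  have "indexed_partition r E pos_vecs"
    using e by (force simp: indexed_partition_def disjoint_family_on_def E_def)
  moreover have "\<exists>m\<in>{1..t}. \<exists>x0\<in>{1..}. \<exists>x :: nat \<Rightarrow> nat. (\<forall>n\<ge>1. x n \<in> {1..}) \<and>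
        (\<forall>h\<in>{x0 + s | s. s \<in> FS x}. \<forall>i\<in>{1..r}. infinite (diag_shift (F m) h \<inter> E i))"
    if F: "indexed_partition t F pos_vecs" for F
  proof -
    obtain m where m: "m \<in> {1..t}"
      and fin: "finite {h. \<exists>i\<in>{1..r}. finite (diag_shift (F m) h \<inter> E i)}"
      using ex_color_finite_bad_shifts[OF words assms(1) F, where k = k] unfolding E_def by blast
    obtain b where b: "\<And>h i. i \<in> {1..r} \<Longrightarrow> finite (diag_shift (F m) h \<inter> E i) \<Longrightarrow> h < b"
      using fin unfolding finite_nat_set_iff_bounded by blast
    \<comment> \<open>Every such \<open>h\<close> exceeds \<open>b\<close> and hence all bad shifts;
      \<open>Suc\<close> makes the starting point positive.\<close>
    have "\<forall>h\<in>{Suc b + s | s. s \<in> FS (\<lambda>_. 1)}. \<forall>i\<in>{1..r}. infinite (diag_shift (F m) h \<inter> E i)"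
      using b by fastforce
    then show ?thesis
      using m by (intro bexI[of _ m] bexI[of _ "Suc b"] exI[of _ "\<lambda>_. 1"]) auto
  qed
  ultimately show ?thesis by blast
qed

end
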